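(* If a finite graph $G$ is strongly $k$-colorable, then it is strongly $(k+1)$-colorable as well.
   Context: A graph $G=(V,E)$ is strongly $k$-colorable if every graph obtained from $G$ by adding to it (the edges of) a union of pairwise vertex-disjoint cliques, each of size at most $k$, on the vertex set $V$ is $k$-colorable. *)

theory Defs
  imports Main
begin

text \<open>Simple graphs are given by a vertex set and a set of two-element edges.\<close>

definition simple_graph :: "'a set \<Rightarrow> 'a set set \<Rightarrow> bool" where
  "simple_graph V E \<longleftrightarrow> (\<forall>e\<in>E. e \<subseteq> V \<and> card e = 2)"

definition colorable :: "'a set \<Rightarrow> 'a set set \<Rightarrow> nat \<Rightarrow> bool" where
  "colorable V E k \<longleftrightarrow>
     (\<exists>c :: 'a \<Rightarrow> nat. (\<forall>v\<in>V. c v < k) \<and> (\<forall>u v. {u, v} \<in> E \<longrightarrow> c u \<noteq> c v))"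

definition clique_edges :: "'a set \<Rightarrow> 'a set set" where
  "clique_edges K = {e. e \<subseteq> K \<and> card e = 2}"

text \<open>
  A union of pairwise vertex-disjoint cliques on the vertex set is represented by the family
  \<open>\<C>\<close> of vertex sets of these cliques; \<open>\<C>\<close> need not cover \<open>V\<close>.
\<close>

definition strongly_colorable :: "'a set \<Rightarrow> 'a set set \<Rightarrow> nat \<Rightarrow> bool" where
  "strongly_colorable V E k \<longleftrightarrow>
     (\<forall>\<C>. (\<forall>K\<in>\<C>. K \<subseteq> V \<and> finite K \<and> card K \<le> k) \<longrightarrow> pairwise disjnt \<C> \<longrightarrow>
        colorable V (E \<union> (\<Union>K\<in>\<C>. clique_edges K)) k)"

end

theory Submission
  imports Defs
begin

text \<open>
  Delete one vertex from every clique of size \<open>k + 1\<close>. In a \<open>k\<close>-coloring of the resulting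
  graph each shortened clique has exactly \<open>k\<close> vertices and hence shows every color. So the color
  class of \<open>0\<close>, without the deleted vertices, is an independent set meeting every clique of size
  \<open>k + 1\<close>. Give it the new color \<open>k\<close>; on its complement all cliques have size at most \<open>k\<close>, and a
  second appeal to strong \<open>k\<close>-colorability colors the rest.
\<close>

lemma pair_in_clique_edges_iff: "{u, v} \<in> clique_edges K \<longleftrightarrow> u \<in> K \<and> v \<in> K \<and> u \<noteq> v"
  by (auto simp: clique_edges_def card_insert_if)

text \<open>Subsets of pairwise disjoint cliques are again pairwise disjoint, so strong colorability
  applies to the shrunken family. Both colorings of the argument come from here, with different
  choices of \<open>f\<close>; properness on a clique is stated as injectivity, which suits counting
  colors.\<close>

lemma strongly_colorable_shrink_cliquesE:
  assumes "strongly_colorable V E k" and disj: "pairwise disjnt \<C>"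
    and f: "\<And>K. K \<in> \<C> \<Longrightarrow> f K \<subseteq> K"
    and V: "\<And>K. K \<in> \<C> \<Longrightarrow> f K \<subseteq> V \<and> finite (f K) \<and> card (f K) \<le> k"
  obtains c where "\<And>v. v \<in> V \<Longrightarrow> c v < k"
    and "\<And>u v. {u, v} \<in> E \<Longrightarrow> c u \<noteq> c v"
    and "\<And>K. K \<in> \<C> \<Longrightarrow> inj_on c (f K)"
proof -
  have "pairwise disjnt (f ` \<C>)"
    unfolding pairwise_image
    using disj f by (metis (mono_tags, lifting) disjnt_subset1 disjnt_subset2 pairwise_def)
  moreover have "\<forall>K\<in>f ` \<C>. K \<subseteq> V \<and> finite K \<and> card K \<le> k"
    using V by blast
  ultimately have "colorable V (E \<union> (\<Union>K\<in>f ` \<C>. clique_edges K)) k"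
    using assms(1) unfolding strongly_colorable_def by blast
  then obtain c where c: "\<forall>v\<in>V. c v < k"
    and ne: "\<forall>u v. {u, v} \<in> E \<union> (\<Union>K\<in>f ` \<C>. clique_edges K) \<longrightarrow> c u \<noteq> c v"
    unfolding colorable_def by blast
  have "inj_on c (f K)" if "K \<in> \<C>" for K
  proof (rule inj_onI, rule ccontr)
    fix u v assume "u \<in> f K" "v \<in> f K" "c u = c v" "u \<noteq> v"
    then have "{u, v} \<in> (\<Union>K\<in>f ` \<C>. clique_edges K)"
      using that by (auto simp: pair_in_clique_edges_iff)
    then show False using ne \<open>c u = c v\<close> by simp
  qed
  then show thesis using that[of c] c ne by simp
qed

lemma independent_set_meeting_large_cliques:
  fixes V :: "'a set"
  assumes G: "strongly_colorable V E k"
    and \<C>: "\<And>K. K \<in> \<C> \<Longrightarrow> K \<subseteq> V \<and> finite K \<and> card K \<le> k + 1"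
    and disj: "pairwise disjnt \<C>"
  obtains I where "\<And>u v. {u, v} \<in> E \<Longrightarrow> u \<notin> I \<or> v \<notin> I"
    and "\<And>K u v. K \<in> \<C> \<Longrightarrow> u \<in> K \<inter> I \<Longrightarrow> v \<in> K \<inter> I \<Longrightarrow> u = v"
    and "\<And>K. K \<in> \<C> \<Longrightarrow> card K = k + 1 \<Longrightarrow> K \<inter> I \<noteq> {}"
proof -
  define s :: "'a set \<Rightarrow> 'a" where "s K = (SOME x. x \<in> K)" for K
  define f where "f K = (if card K = k + 1 then K - {s K} else K)" for K
  define R where "R = s ` {K \<in> \<C>. card K = k + 1}"
  have s: "s K \<in> K" if "card K = k + 1" for K
    using that unfolding s_def by (metis card.empty add_is_0 one_neq_zero some_in_eq)
  have card_f: "card (f K) = k" if "card K = k + 1" for K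
    using that s[OF that] by (simp add: f_def)
  have "f K \<subseteq> V \<and> finite (f K) \<and> card (f K) \<le> k" if "K \<in> \<C>" for K
    using \<C>[OF that] card_f[of K] by (cases "card K = k + 1") (auto simp: f_def)
  moreover have "f K \<subseteq> K" for K by (auto simp: f_def)
  ultimately obtain c where c: "\<And>v. v \<in> V \<Longrightarrow> c v < k"
    and cE: "\<And>u v. {u, v} \<in> E \<Longrightarrow> c u \<noteq> c v"
    and inj: "\<And>K. K \<in> \<C> \<Longrightarrow> inj_on c (f K)"
    using strongly_colorable_shrink_cliquesE[OF G disj, of f] by blast
  \<comment> \<open>Disjointness ensures that no vertex of \<open>K\<close> is deleted on account of
    another clique, so all of \<open>f K\<close> survives the removal of \<open>R\<close> when
    \<open>K\<close> has size \<open>k + 1\<close>.\<close>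
  have meet: "K \<inter> R \<subseteq> {s K}" if "K \<in> \<C>" for K
  proof
    fix x assume "x \<in> K \<inter> R"
    then obtain L where L: "L \<in> \<C>" "card L = k + 1" "x = s L" and "x \<in> K"
      by (auto simp: R_def)
    then have "\<not> disjnt K L" using s[of L] by (auto simp: disjnt_def)
    then show "x \<in> {s K}" using disj that L by (auto simp: pairwise_def)
  qed
  show thesis
  \<comment> \<open>A deleted vertex has lost the added edges to the rest of its clique, so it may
    share color \<open>0\<close> with another vertex there. Discarding \<open>R\<close> rules this
    out.\<close>
  proof (rule that[of "{v. c v = 0} - R"])
    show "u \<notin> {v. c v = 0} - R \<or> v \<notin> {v. c v = 0} - R" if "{u, v} \<in> E" for u v
      using cE[OF that] by auto
  next
    fix K u v
    assume K: "K \<in> \<C>" and "u \<in> K \<inter> ({v. c v = 0} - R)" "v \<in> K \<inter> ({v. c v = 0} - R)"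
    \<comment> \<open>The only vertex of \<open>K\<close> that \<open>f K\<close> can miss is
      \<open>s K\<close>, and in that case it belongs to \<open>R\<close>.\<close>
    moreover from this have "u \<in> f K" "v \<in> f K"
      by (auto simp: f_def R_def)
    ultimately show "u = v" using inj_onD[OF inj[OF K], of u v] by simp
  next
    fix K assume K: "K \<in> \<C>" "card K = k + 1"
    have "K \<subseteq> V" using \<C> K by blast
    \<comment> \<open>Color \<open>0\<close> is available only for positive \<open>k\<close>; the
      color of \<open>s K\<close> is a natural number below \<open>k\<close>.\<close>
    with s[OF K(2)] c[of "s K"] have "k > 0" by auto
    have "c ` f K \<subseteq> {..<k}" using \<open>K \<subseteq> V\<close> c by (auto simp: f_def)
    moreover have "card (c ` f K) = k" using inj[OF K(1)] card_f[OF K(2)] by (simp add: card_image)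
    ultimately have "c ` f K = {..<k}" by (simp add: card_subset_eq)
    then obtain v where "v \<in> f K" "c v = 0" using \<open>k > 0\<close> by (metis imageE lessThan_iff)
    then show "K \<inter> ({v. c v = 0} - R) \<noteq> {}"
      using meet[OF K(1)] K(2) by (auto simp: f_def)
  qed
qed

theorem theorem7p1:
  fixes V :: "'a set" and E :: "'a set set" and k :: nat
  assumes "finite V"
    and "simple_graph V E"
    and "strongly_colorable V E k"
  shows "strongly_colorable V E (k + 1)"
  unfolding strongly_colorable_def
proof (intro allI impI)
  fix \<C> :: "'a set set"
  assume \<C>: "\<forall>K\<in>\<C>. K \<subseteq> V \<and> finite K \<and> card K \<le> k + 1" and disj: "pairwise disjnt \<C>"
  obtain I where IE: "\<And>u v. {u, v} \<in> E \<Longrightarrow> u \<notin> I \<or> v \<notin> I"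
    and I\<C>: "\<And>K u v. K \<in> \<C> \<Longrightarrow> u \<in> K \<inter> I \<Longrightarrow> v \<in> K \<inter> I \<Longrightarrow> u = v"
    and meet: "\<And>K. K \<in> \<C> \<Longrightarrow> card K = k + 1 \<Longrightarrow> K \<inter> I \<noteq> {}"
    using independent_set_meeting_large_cliques[OF assms(3) _ disj] \<C> by blast
  have "K - I \<subseteq> V \<and> finite (K - I) \<and> card (K - I) \<le> k" if K: "K \<in> \<C>" for K
  proof (cases "card K = k + 1")
    case True
    then have "K - I \<subset> K" using meet[OF K] by blast
    then have "card (K - I) < card K" using \<C> K by (simp add: psubset_card_mono)
    then show ?thesis using True \<C> K by auto
  next
    case False
    then have "card K \<le> k" using \<C> K by force
    moreover have "card (K - I) \<le> card K" using \<C> K by (simp add: card_mono)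
    ultimately show ?thesis using \<C> K by auto
  qed
  then obtain c where c: "\<And>v. v \<in> V \<Longrightarrow> c v < k"
    and cE: "\<And>u v. {u, v} \<in> E \<Longrightarrow> c u \<noteq> c v"
    and inj: "\<And>K. K \<in> \<C> \<Longrightarrow> inj_on c (K - I)"
    using strongly_colorable_shrink_cliquesE[OF assms(3) disj, of "\<lambda>K. K - I"] by blast
  define d where "d v = (if v \<in> I then k else c v)" for v
  have "d u \<noteq> d v" if uv: "{u, v} \<in> E \<union> (\<Union>K\<in>\<C>. clique_edges K)" for u v
  proof -
    consider "{u, v} \<in> E" | K where "K \<in> \<C>" "u \<in> K" "v \<in> K" "u \<noteq> v"
      using uv by (auto simp: pair_in_clique_edges_iff)
    then show ?thesis
    proof cases
      case 1
      \<comment> \<open>If exactly one endpoint lies in \<open>I\<close>, the other must avoid the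
        color \<open>k\<close>. The bound on \<open>c\<close> holds only on \<open>V\<close>, so the
        edge has to be placed inside \<open>V\<close> first.\<close>
      then have "c u < k" "c v < k" using assms(2) c by (auto simp: simple_graph_def)
      then show ?thesis using IE[OF 1] cE[OF 1] by (auto simp: d_def)
    next
      case (2 K)
      then have "c u < k" "c v < k" using \<C> c by auto
      then show ?thesis
        using 2 I\<C>[of K u v] inj_onD[OF inj, of K u v] by (auto simp: d_def)
    qed
  qed
  moreover have "\<forall>v\<in>V. d v < k + 1" using c by (auto simp: d_def less_Suc_eq)
  ultimately show "colorable V (E \<union> (\<Union>K\<in>\<C>. clique_edges K)) (k + 1)"
    unfolding colorable_def by blast
qed

end
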